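(* Let $n\ge 6$, $n-1\le m\le 2n-4$, and let $G$ be a $4$-Sachs minimal graph in $\mathfrak{G}_{n,m}$ with $\Delta(G)<n-1$. Then $G$ is the difference graph with vertex-eigenvector $(1,1;m-n+2,2n-4-m)$, i.e. $V(G)=\{x_1,x_2\}\cup Y_1\cup Y_2$ (disjoint) with $|Y_1|=m-n+2$, $|Y_2|=2n-4-m$, where $x_1$ is adjacent to every vertex of $Y_1\cup Y_2$, $x_2$ is adjacent to exactly the vertices of $Y_1$, and there are no other edges.
   Context: $\mathfrak{G}_{n,m}$ is the set of connected simple graphs with $n$ vertices and $m$ edges. $\mathbf{a}_4(G)$ is the coefficient of $\lambda^{n-4}$ in $\det(\lambda\mathbf{I}-\mathbf{A}(G))$ (equivalently, number of 2-matchings minus twice the number of 4-cycles). $G\in\mathfrak{G}_{n,m}$ is $4$-Sachs minimal if $\mathbf{a}_4(G)=\min\{\mathbf{a}_4(H):H\in\mathfrak{G}_{n,m}\}$. $\Delta(G)$ is the maximum degree. *)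

theory Defs
  imports Main
begin

text \<open>A simple graph on the vertex set {0..<n} is represented by its edge set E,
  a set of 2-element subsets of {0..<n}.\<close>

definition simple_graph :: "nat \<Rightarrow> nat set set \<Rightarrow> bool" where
  "simple_graph n E \<longleftrightarrow> (\<forall>e\<in>E. e \<subseteq> {0..<n} \<and> card e = 2)"

definition adj_rel :: "nat set set \<Rightarrow> (nat \<times> nat) set" where
  "adj_rel E = {(u, v). {u, v} \<in> E}"

definition connected_graph :: "nat \<Rightarrow> nat set set \<Rightarrow> bool" where
  "connected_graph n E \<longleftrightarrow> (\<forall>u\<in>{0..<n}. \<forall>v\<in>{0..<n}. (u, v) \<in> (adj_rel E)\<^sup>*)"

text \<open>The class G_{n,m} of connected simple graphs with n vertices and m edges.\<close>
definition graphs_nm :: "nat \<Rightarrow> nat \<Rightarrow> nat set set set" where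
  "graphs_nm n m = {E. simple_graph n E \<and> connected_graph n E \<and> card E = m}"

text \<open>Number of 2-matchings: unordered pairs of disjoint edges.\<close>
definition two_matchings :: "nat set set \<Rightarrow> nat" where
  "two_matchings E = card {{e, f} | e f. e \<in> E \<and> f \<in> E \<and> e \<inter> f = {}}"

text \<open>Number of 4-cycles (as subgraphs, i.e. sets of four edges forming a cycle).\<close>
definition four_cycles :: "nat set set \<Rightarrow> nat" where
  "four_cycles E = card {{{a, b}, {b, c}, {c, d}, {d, a}} | a b c d.
      distinct [a, b, c, d] \<and> {a, b} \<in> E \<and> {b, c} \<in> E \<and> {c, d} \<in> E \<and> {d, a} \<in> E}"

text \<open>a_4(G): number of 2-matchings minus twice the number of 4-cycles.\<close>
definition a4 :: "nat set set \<Rightarrow> int" where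
  "a4 E = int (two_matchings E) - 2 * int (four_cycles E)"

definition sachs4_minimal :: "nat \<Rightarrow> nat \<Rightarrow> nat set set \<Rightarrow> bool" where
  "sachs4_minimal n m E \<longleftrightarrow> E \<in> graphs_nm n m \<and> (\<forall>H\<in>graphs_nm n m. a4 E \<le> a4 H)"

definition degree :: "nat set set \<Rightarrow> nat \<Rightarrow> nat" where
  "degree E v = card {u. {u, v} \<in> E}"

definition max_degree :: "nat \<Rightarrow> nat set set \<Rightarrow> nat" where
  "max_degree n E = Max (degree E ` {0..<n})"

end

theory Submission
  imports Defs
begin

text \<open>Write \<open>n' = n - 1\<close>, \<open>k = m - n + 2\<close> and \<open>B n m = k (n - 2 - k)\<close>, the value of \<open>a4\<close> at the
  difference graph. Deleting a vertex \<open>u\<close> of degree \<open>d\<close> leaves \<open>m' = m - d\<close> edges and lowers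
  \<open>a4\<close> by \<open>d m'\<close> minus the sum over all remaining \<open>x\<close> of \<open>t x\<^sup>2\<close>, where \<open>t x\<close> counts the common
  neighbours of \<open>u\<close> and \<open>x\<close>.

  If some \<open>z\<close> has degree \<open>n - 2\<close>, delete \<open>z\<close> and then its only non-neighbour \<open>u\<close>: the formula
  gives \<open>a4 \<ge> B n m + h\<close>, where \<open>h\<close> is the number of edges avoiding \<open>z\<close> and \<open>u\<close>, and \<open>h = 0\<close>
  means a difference graph. If all degrees are at most \<open>n - 3\<close>, delete a non-cut vertex. What
  remains is connected with degrees at most \<open>n' - 2\<close>, so by induction its \<open>a4\<close> is at least
  \<open>B n' m'\<close>; counting edges at the neighbours of \<open>u\<close> against connectivity shows that the deleted
  part contributes more than \<open>B n m - B n' m'\<close>, except for equality when \<open>d = 2\<close> and every remaining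
  edge has exactly one end adjacent to \<open>u\<close>; then the remaining degrees are at most \<open>n' - 3\<close> and
  induction is strict. Hence \<open>a4 > B n m\<close>, which contradicts minimality.\<close>

section \<open>Edge counts and degrees in induced subgraphs\<close>

locale sgraph =
  fixes E :: "nat set set"
  assumes card_edge: "e \<in> E \<Longrightarrow> card e = 2"
begin

definition A :: "nat \<Rightarrow> nat \<Rightarrow> int" where
  "A x y = of_bool ({x, y} \<in> E)"

definition ind :: "nat set \<Rightarrow> nat set set" where
  "ind W = {e \<in> E. e \<subseteq> W}"

definition size_on :: "nat set \<Rightarrow> int" where
  "size_on W = int (card (ind W))"

text \<open>The vertex \<open>x\<close> may lie outside \<open>W\<close>: when \<open>W\<close> is
  the neighbourhood of \<open>u\<close>, this is the codegree \<open>t x\<close> of the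
  overview.\<close>

definition deg_on :: "nat set \<Rightarrow> nat \<Rightarrow> int" where
  "deg_on W x = (\<Sum>w\<in>W. A w x)"

lemma A_refl [simp]: "A x x = 0"
  using card_edge[of "{x, x}"] by (auto simp: A_def)

lemma A_sym: "A x y = A y x"
  by (simp add: A_def insert_commute)

lemma A_bounds: "0 \<le> A x y" "A x y \<le> 1"
  by (auto simp: A_def)

lemma A_idem [simp]: "A x y * A x y = A x y"
  by (auto simp: A_def)

lemma deg_on_nonneg: "0 \<le> deg_on W x"
  by (simp add: deg_on_def sum_nonneg A_bounds)

lemma deg_on_le_card: "deg_on W x \<le> int (card W)"
  using sum_bounded_above[of W "\<lambda>w. A w x" 1] A_bounds by (simp add: deg_on_def)

lemma deg_on_insert:
  assumes "finite W" "u \<notin> W"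
  shows "deg_on (insert u W) x = deg_on W x + A u x"
  using assms by (simp add: deg_on_def)

lemma deg_on_remove:
  assumes "finite W"
  shows "deg_on (W - {x}) x = deg_on W x"
proof (cases "x \<in> W")
  case True
  then have W: "W = insert x (W - {x})" by blast
  have "deg_on W x = deg_on (W - {x}) x + A x x"
    using assms deg_on_insert[of "W - {x}" x x] W by simp
  then show ?thesis by simp
qed simp

lemma deg_on_mono:
  assumes "finite W" "W' \<subseteq> W"
  shows "deg_on W' x \<le> deg_on W x"
  using assms by (simp add: deg_on_def sum_mono2 A_bounds)

lemma deg_on_less_card:
  assumes "finite W" "x \<in> W"
  shows "deg_on W x \<le> int (card W) - 1"
proof -
  have "deg_on W x \<le> int (card (W - {x}))"
    using deg_on_remove[OF assms(1), of x] deg_on_le_card[of "W - {x}" x] by simp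
  moreover have "card W \<ge> 1" using assms by (metis One_nat_def Suc_leI card_gt_0_iff empty_iff)
  ultimately show ?thesis using assms by (simp add: of_nat_diff)
qed

lemma sum_A: "finite W \<Longrightarrow> (\<Sum>w\<in>W. A w x) = int (card {w \<in> W. {w, x} \<in> E})"
  by (simp add: A_def Int_def)

lemma deg_on_card: "finite W \<Longrightarrow> deg_on W x = int (card {w \<in> W. {w, x} \<in> E})"
  by (simp add: deg_on_def sum_A)

lemma finite_ind: "finite W \<Longrightarrow> finite (ind W)"
  by (rule finite_subset[of _ "Pow W"]) (auto simp: ind_def)

lemma ind_insert: "ind (insert u W) = ind W \<union> (\<lambda>w. {u, w}) ` {w \<in> W. {u, w} \<in> E}"
proof
  show "ind (insert u W) \<subseteq> ind W \<union> (\<lambda>w. {u, w}) ` {w \<in> W. {u, w} \<in> E}"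
  proof
    fix e assume e: "e \<in> ind (insert u W)"
    then have E: "e \<in> E" "e \<subseteq> insert u W" by (auto simp: ind_def)
    obtain p q where "e = {p, q}" "p \<noteq> q" using card_edge[OF E(1)] by (meson card_2_iff)
    then show "e \<in> ind W \<union> (\<lambda>w. {u, w}) ` {w \<in> W. {u, w} \<in> E}"
      using E by (auto simp: ind_def insert_commute)
  qed
qed (auto simp: ind_def)

lemma inj_star: "inj_on (\<lambda>w. {u, w}) S"
  by (auto simp: inj_on_def doubleton_eq_iff)

lemma size_on_insert:
  assumes "finite W" "u \<notin> W"
  shows "size_on (insert u W) = size_on W + deg_on W u"
proof -
  have "card (ind (insert u W)) = card (ind W) + card {w \<in> W. {u, w} \<in> E}"
    unfolding ind_insert using assms
    by (subst card_Un_disjoint) (auto simp: finite_ind card_image[OF inj_star], auto simp: ind_def)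
  then show ?thesis using assms by (simp add: size_on_def deg_on_card insert_commute)
qed

lemma size_on_nonneg: "0 \<le> size_on W"
  by (simp add: size_on_def)

lemma size_on_empty [simp]: "size_on {} = 0"
  using card_edge by (fastforce simp: size_on_def ind_def)

lemma handshake: "finite W \<Longrightarrow> (\<Sum>x\<in>W. deg_on W x) = 2 * size_on W"
proof (induction W rule: finite_induct)
  case (insert u W)
  have "(\<Sum>x\<in>W. deg_on (insert u W) x) = (\<Sum>x\<in>W. deg_on W x) + (\<Sum>x\<in>W. A u x)"
    using insert by (simp add: deg_on_insert sum.distrib)
  moreover have "(\<Sum>x\<in>W. A u x) = deg_on W u" by (simp add: deg_on_def A_sym)
  moreover have "deg_on (insert u W) u = deg_on W u" using insert by (simp add: deg_on_insert)
  ultimately show ?case using insert by (simp add: size_on_insert)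
qed simp

text \<open>Double counting of adjacent pairs. With \<open>P\<close> the vertex set and
  \<open>Q\<close> the neighbourhood of \<open>u\<close>, it trades codegrees with \<open>u\<close>
  for degrees of the neighbours of \<open>u\<close>.\<close>

lemma sum_deg_swap: "(\<Sum>x\<in>P. deg_on Q x) = (\<Sum>x\<in>Q. deg_on P x)"
  unfolding deg_on_def by (subst sum.swap) (simp add: A_sym)

text \<open>Splitting both the vertices and their degrees in \<open>handshake\<close> along
  \<open>N\<close> counts the edges between \<open>N\<close> and \<open>W - N\<close> once from each
  side.\<close>

lemma size_on_split:
  assumes "finite W" "N \<subseteq> W"
  shows "size_on W = size_on N + (\<Sum>x\<in>W - N. deg_on N x) + size_on (W - N)"
proof -
  have fin: "finite N" "finite (W - N)" using assms finite_subset by auto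
  have split: "(\<Sum>x\<in>W. f x) = (\<Sum>x\<in>N. f x) + (\<Sum>x\<in>W - N. f x)" for f :: "nat \<Rightarrow> int"
    using assms by (metis sum.subset_diff add.commute)
  have deg: "deg_on W x = deg_on N x + deg_on (W - N) x" for x
    unfolding deg_on_def by (rule split)
  have "2 * size_on W = (\<Sum>x\<in>N. deg_on N x) + (\<Sum>x\<in>N. deg_on (W - N) x)
      + ((\<Sum>x\<in>W - N. deg_on N x) + (\<Sum>x\<in>W - N. deg_on (W - N) x))"
    using handshake[OF assms(1)] by (simp add: split deg sum.distrib)
  also have "(\<Sum>x\<in>N. deg_on (W - N) x) = (\<Sum>x\<in>W - N. deg_on N x)"
    by (rule sum_deg_swap)
  finally show ?thesis using handshake[OF fin(1)] handshake[OF fin(2)] by simp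
qed

section \<open>Change of \<open>a4\<close> when a vertex is added\<close>

lemma card_ind_avoid:
  assumes "finite W" "w \<in> W"
  shows "int (card {f \<in> ind W. w \<notin> f}) = size_on W - deg_on W w"
proof -
  have "{f \<in> ind W. w \<notin> f} = ind (W - {w})" by (auto simp: ind_def)
  moreover have "size_on W = size_on (W - {w}) + deg_on (W - {w}) w"
    using size_on_insert[of "W - {w}" w] assms by (simp add: insert_absorb)
  ultimately show ?thesis using deg_on_remove[OF assms(1), of w] by (simp add: size_on_def)
qed

text \<open>Two edges at \<open>u\<close> are never disjoint, so a new 2-matching is an edge
  \<open>{u, w}\<close> together with an old edge avoiding \<open>w\<close>; \<open>?S\<close> lists
  these choices.\<close>

lemma two_matchings_insert:
  assumes "finite W" "u \<notin> W"
  defines "N \<equiv> {w \<in> W. {w, u} \<in> E}"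
  shows "int (two_matchings (ind (insert u W)))
    = int (two_matchings (ind W)) + (\<Sum>w\<in>N. size_on W - deg_on W w)"
proof -
  let ?M = "\<lambda>X. {{e, f} | e f. e \<in> X \<and> f \<in> X \<and> e \<inter> f = {}}"
  let ?S = "SIGMA w:N. {f \<in> ind W. w \<notin> f}"
  let ?g = "\<lambda>(w, f). {{u, w}, f}"
  have fW: "finite (ind W)" and fN: "finite N" using assms finite_ind by auto
  have u_notin: "u \<notin> f" if "f \<in> ind W" for f using that assms by (auto simp: ind_def)
  have ii: "ind (insert u W) = ind W \<union> (\<lambda>w. {u, w}) ` N"
    by (simp add: ind_insert N_def insert_commute)
  have eq: "?M (ind (insert u W)) = ?M (ind W) \<union> ?g ` ?S"
  proof
    show "?M (ind (insert u W)) \<subseteq> ?M (ind W) \<union> ?g ` ?S"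
    proof
      fix p assume "p \<in> ?M (ind (insert u W))"
      then obtain e f where p: "p = {e, f}" "e \<in> ind W \<union> (\<lambda>w. {u, w}) ` N"
        "f \<in> ind W \<union> (\<lambda>w. {u, w}) ` N" "e \<inter> f = {}"
        unfolding ii by blast
      consider "e \<in> ind W" "f \<in> ind W" | w where "w \<in> N" "e = {u, w}" "f \<in> ind W"
        | w where "w \<in> N" "f = {u, w}" "e \<in> ind W"
        using p by blast
      then show "p \<in> ?M (ind W) \<union> ?g ` ?S"
      proof cases
        case 1
        then show ?thesis using p by blast
      next
        case 2
        then have "p = ?g (w, f)" "(w, f) \<in> ?S" using p by auto
        then show ?thesis by blast
      next
        case 3
        then have "p = ?g (w, e)" "(w, e) \<in> ?S" using p by auto
        then show ?thesis by blast
      qed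
    qed
    show "?M (ind W) \<union> ?g ` ?S \<subseteq> ?M (ind (insert u W))"
    proof (intro Un_least image_subsetI)
      show "?M (ind W) \<subseteq> ?M (ind (insert u W))" unfolding ii by blast
    next
      fix s assume s: "s \<in> ?S"
      obtain w f where wf: "s = (w, f)" "w \<in> N" "f \<in> ind W" "w \<notin> f" using s by auto
      have "{u, w} \<in> ind (insert u W)" "f \<in> ind (insert u W)" "{u, w} \<inter> f = {}"
        using wf u_notin by (auto simp: ii)
      then show "?g s \<in> ?M (ind (insert u W))" unfolding wf(1) prod.case by blast
    qed
  qed
  have inj: "inj_on ?g ?S"
  proof (rule inj_onI)
    fix s s' assume "s \<in> ?S" "s' \<in> ?S" "?g s = ?g s'"
    moreover obtain w f where "s = (w, f)" by fastforce
    moreover obtain w' f' where "s' = (w', f')" by fastforce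
    ultimately show "s = s'" using u_notin
      by (auto simp: doubleton_eq_iff)
  qed
  have fin: "finite (?M (ind W))"
    by (rule finite_subset[of _ "Pow (ind W)"]) (use fW in auto)
  have u_old: "u \<notin> \<Union>p" if "p \<in> ?M (ind W)" for p using that u_notin by auto
  have u_new: "u \<in> \<Union>p" if "p \<in> ?g ` ?S" for p using that by auto
  have disj: "?M (ind W) \<inter> ?g ` ?S = {}"
    using u_old u_new by (meson disjoint_iff)
  have finS: "finite (?g ` ?S)" using fN fW by (intro finite_imageI finite_SigmaI) auto
  have "card (?M (ind (insert u W))) = card (?M (ind W)) + card ?S"
    unfolding eq card_Un_disjoint[OF fin finS disj] card_image[OF inj] ..
  moreover have "int (card ?S) = (\<Sum>w\<in>N. size_on W - deg_on W w)"
    using fN fW by (subst card_SigmaI) (auto simp: card_ind_avoid[OF assms(1)] N_def)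
  ultimately show ?thesis by (simp add: two_matchings_def)
qed

lemma four_cycles_insert:
  assumes "finite W" "u \<notin> W"
  defines "T \<equiv> \<lambda>y. {w \<in> W. {w, u} \<in> E \<and> {w, y} \<in> E}"
  shows "four_cycles (ind (insert u W)) = four_cycles (ind W) + (\<Sum>y\<in>W. card (T y) choose 2)"
proof -
  let ?C = "\<lambda>X. {{{a, b}, {b, c}, {c, d}, {d, a}} | a b c d.
      distinct [a, b, c, d] \<and> {a, b} \<in> X \<and> {b, c} \<in> X \<and> {c, d} \<in> X \<and> {d, a} \<in> X}"
  let ?S = "SIGMA y:W. {P. P \<subseteq> T y \<and> card P = 2}"
  let ?g = "\<lambda>(y, P). (\<lambda>p. {u, p}) ` P \<union> (\<lambda>p. {y, p}) ` P"
  have loop: "{x} \<notin> E" for x using card_edge[of "{x}"] by auto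
  have fW: "finite (ind W)" using assms finite_ind by auto
  have fT: "finite (T y)" for y using assms by (simp add: T_def)
  have u_notin: "u \<notin> f" if "f \<in> ind W" for f using that assms by (auto simp: ind_def)
  have mem: "{x, y} \<in> ind V \<longleftrightarrow> {x, y} \<in> E \<and> x \<in> V \<and> y \<in> V" for x y V by (auto simp: ind_def)
  \<comment> \<open>A cycle written from \<open>u\<close> on has \<open>c\<close> opposite to
    \<open>u\<close> and \<open>{b, d}\<close> as its pair of common neighbours. Rotation brings
    every other position of \<open>u\<close> to this form.\<close>
  have thru: "{{u, b}, {b, c}, {c, d}, {d, u}} \<in> ?g ` ?S"
    if "distinct [u, b, c, d]" "{u, b} \<in> ind (insert u W)" "{b, c} \<in> ind (insert u W)"
      "{c, d} \<in> ind (insert u W)" "{d, u} \<in> ind (insert u W)" for b c d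
  proof -
    have "(c, {b, d}) \<in> ?S" using that by (auto simp: mem T_def insert_commute)
    moreover have "{{u, b}, {b, c}, {c, d}, {d, u}} = ?g (c, {b, d})"
      by (simp add: insert_commute)
    ultimately show ?thesis by (rule rev_image_eqI)
  qed
  have eq: "?C (ind (insert u W)) = ?C (ind W) \<union> ?g ` ?S"
  proof
    show "?C (ind (insert u W)) \<subseteq> ?C (ind W) \<union> ?g ` ?S"
    proof
      fix p assume "p \<in> ?C (ind (insert u W))"
      then obtain a b c d where p: "p = {{a, b}, {b, c}, {c, d}, {d, a}}" "distinct [a, b, c, d]"
        "{a, b} \<in> ind (insert u W)" "{b, c} \<in> ind (insert u W)"
        "{c, d} \<in> ind (insert u W)" "{d, a} \<in> ind (insert u W)" by blast
      consider "u = a" | "u = b" | "u = c" | "u = d" | "u \<notin> {a, b, c, d}" by blast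
      then show "p \<in> ?C (ind W) \<union> ?g ` ?S"
      proof cases
        case 1
        then show ?thesis using p thru[of b c d] by simp
      next
        case 2
        have "p = {{u, c}, {c, d}, {d, a}, {a, u}}" using 2 p(1) by blast
        then show ?thesis using 2 p thru[of c d a] by simp
      next
        case 3
        have "p = {{u, d}, {d, a}, {a, b}, {b, u}}" using 3 p(1) by blast
        then show ?thesis using 3 p thru[of d a b] by simp
      next
        case 4
        have "p = {{u, a}, {a, b}, {b, c}, {c, u}}" using 4 p(1) by blast
        then show ?thesis using 4 p thru[of a b c] by simp
      next
        case 5
        then have "{a, b} \<in> ind W" "{b, c} \<in> ind W" "{c, d} \<in> ind W" "{d, a} \<in> ind W"
          using p by (auto simp: mem)
        then show ?thesis using p(1,2) by blast
      qed
    qed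
    show "?C (ind W) \<union> ?g ` ?S \<subseteq> ?C (ind (insert u W))"
    proof (intro Un_least image_subsetI)
      have "ind W \<subseteq> ind (insert u W)" by (auto simp: ind_def)
      then show "?C (ind W) \<subseteq> ?C (ind (insert u W))" by blast
    next
      fix s assume s: "s \<in> ?S"
      obtain y P where yP: "s = (y, P)" "y \<in> W" "P \<subseteq> T y" "card P = 2" using s by auto
      obtain p q where pq: "P = {p, q}" "p \<noteq> q" using yP(4) by (meson card_2_iff)
      have *: "?g s = {{u, p}, {p, y}, {y, q}, {q, u}}"
        by (simp add: yP pq insert_commute)
      have "distinct [u, p, y, q]"
        using yP pq assms(2) loop by (auto simp: T_def)
      moreover have "{u, p} \<in> ind (insert u W)" "{p, y} \<in> ind (insert u W)"
        "{y, q} \<in> ind (insert u W)" "{q, u} \<in> ind (insert u W)"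
        using yP pq by (auto simp: T_def mem insert_commute)
      ultimately show "?g s \<in> ?C (ind (insert u W))" unfolding * by blast
    qed
  qed
  \<comment> \<open>The cycle determines its code: \<open>P\<close> consists of the vertices joined
    to \<open>u\<close>, and the vertices joined to a member of \<open>P\<close> are
    \<open>u\<close> and \<open>y\<close>.\<close>
  have inj: "inj_on ?g ?S"
  proof (rule inj_onI)
    fix s s' assume s: "s \<in> ?S" and s': "s' \<in> ?S" and g: "?g s = ?g s'"
    have nbrs: "{x. {u, x} \<in> ?g (y, P)} = P" if "(y, P) \<in> ?S" for y P
    proof -
      have "u \<noteq> y" "u \<notin> P" using that assms(2) by (auto simp: T_def)
      then show ?thesis by (auto simp: doubleton_eq_iff)
    qed
    have opp: "{x. \<exists>p\<in>P. {p, x} \<in> ?g (y, P)} = {u, y}" if "(y, P) \<in> ?S" for y P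
    proof -
      have "u \<notin> P" "y \<notin> P" "P \<noteq> {}" using that assms(2) loop by (auto simp: T_def)
      then show ?thesis by (auto simp: doubleton_eq_iff image_iff)
    qed
    obtain y P where yP: "s = (y, P)" by fastforce
    obtain y' P' where yP': "s' = (y', P')" by fastforce
    have S: "(y, P) \<in> ?S" "(y', P') \<in> ?S" using s s' unfolding yP yP' .
    have gg: "?g (y, P) = ?g (y', P')" using g unfolding yP yP' .
    have "P = {x. {u, x} \<in> ?g (y, P)}" by (rule nbrs[OF S(1), symmetric])
    also have "\<dots> = {x. {u, x} \<in> ?g (y', P')}" by (simp only: gg)
    also have "\<dots> = P'" by (rule nbrs[OF S(2)])
    finally have P: "P = P'" .
    have "{u, y} = {x. \<exists>p\<in>P. {p, x} \<in> ?g (y, P)}" by (rule opp[OF S(1), symmetric])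
    also have "\<dots> = {x. \<exists>p\<in>P'. {p, x} \<in> ?g (y', P')}" by (simp only: gg P[symmetric])
    also have "\<dots> = {u, y'}" by (rule opp[OF S(2)])
    finally have "{u, y} = {u, y'}" .
    moreover have "u \<noteq> y" "u \<noteq> y'" using s s' yP yP' assms(2) by auto
    ultimately show "s = s'" using yP yP' P by (simp add: doubleton_eq_iff)
  qed
  have fin: "finite (?C (ind W))"
    by (rule finite_subset[of _ "Pow (ind W)"]) (use fW in auto)
  have u_old: "u \<notin> \<Union>p" if "p \<in> ?C (ind W)" for p using that u_notin by auto
  have u_new: "u \<in> \<Union>p" if "p \<in> ?g ` ?S" for p
  proof -
    obtain y P where yP: "p = ?g (y, P)" "card P = 2" using \<open>p \<in> ?g ` ?S\<close> by blast
    then obtain q where "q \<in> P" by fastforce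
    then show ?thesis using yP(1) by auto
  qed
  have disj: "?C (ind W) \<inter> ?g ` ?S = {}"
    using u_old u_new by (meson disjoint_iff)
  have finS: "finite {P. P \<subseteq> T y \<and> card P = 2}" for y
    by (rule finite_subset[of _ "Pow (T y)"]) (use fT in auto)
  then have finS': "finite (?g ` ?S)" using assms(1) by (intro finite_imageI finite_SigmaI) auto
  have "card (?C (ind (insert u W))) = card (?C (ind W)) + card ?S"
    unfolding eq card_Un_disjoint[OF fin finS' disj] card_image[OF inj] ..
  moreover have "card ?S = (\<Sum>y\<in>W. card (T y) choose 2)"
    using assms(1) finS by (subst card_SigmaI) (auto simp: n_subsets[OF fT])
  ultimately show ?thesis by (simp add: four_cycles_def)
qed

text \<open>Each four-cycle through \<open>u\<close> is determined by the vertex opposite to \<open>u\<close> and a pair of common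
  neighbours. The negative part of the increment thus combines with the number of edges at the
  neighbours of \<open>u\<close> to a sum of squares.\<close>

lemma a4_insert:
  assumes "finite W" "u \<notin> W"
  defines "N \<equiv> {w \<in> W. {w, u} \<in> E}"
  shows "a4 (ind (insert u W))
    = a4 (ind W) + int (card N) * size_on W - (\<Sum>x\<in>W. (deg_on N x)\<^sup>2)"
proof -
  have fN: "finite N" "N \<subseteq> W" using assms by (auto simp: N_def)
  have T: "{w \<in> W. {w, u} \<in> E \<and> {w, y} \<in> E} = {w \<in> N. {w, y} \<in> E}" for y
    by (auto simp: N_def)
  have ch: "2 * int (k choose 2) = (int k)\<^sup>2 - int k" for k
  proof (induction k)
    case (Suc k)
    then show ?case by (simp add: numeral_2_eq_2 algebra_simps power2_eq_square)
  qed simp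
  have "2 * int (\<Sum>y\<in>W. card {w \<in> N. {w, y} \<in> E} choose 2)
      = (\<Sum>y\<in>W. (deg_on N y)\<^sup>2) - (\<Sum>y\<in>W. deg_on N y)"
    by (simp add: sum_distrib_left ch sum_subtractf deg_on_card[OF fN(1)])
  \<comment> \<open>Hence the linear terms of the two increments cancel and only the squares
    remain.\<close>
  moreover have "(\<Sum>y\<in>W. deg_on N y) = (\<Sum>w\<in>N. deg_on W w)" by (rule sum_deg_swap)
  ultimately show ?thesis
    using four_cycles_insert[OF assms(1,2)] two_matchings_insert[OF assms(1,2)]
    unfolding T by (simp add: a4_def N_def[symmetric] sum_subtractf)
qed

section \<open>Sums of squared degrees\<close>

lemma deg_on_nbrs:
  assumes "finite W"
  shows "deg_on {w \<in> W. {w, u} \<in> E} u = deg_on W u"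
    and "int (card {w \<in> W. {w, u} \<in> E}) = deg_on W u"
  using assms by (simp_all add: deg_on_card)

text \<open>Each neighbour of \<open>u\<close> gains one degree, which adds twice its old degree
  plus 1; the old degrees over \<open>N\<close> sum to the codegrees. The vertex \<open>u\<close>
  itself adds the square of \<open>card N\<close>.\<close>

lemma sum_deg_sq_insert:
  assumes "finite W" "u \<notin> W"
  defines "N \<equiv> {w \<in> W. {w, u} \<in> E}"
  shows "(\<Sum>x\<in>insert u W. (deg_on (insert u W) x)\<^sup>2)
    = (\<Sum>x\<in>W. (deg_on W x)\<^sup>2) + 2 * (\<Sum>x\<in>W. deg_on N x) + int (card N) + (int (card N))\<^sup>2"
proof -
  have fN: "finite N" "N \<subseteq> W" using assms by (auto simp: N_def)
  have d: "int (card N) = deg_on W u" using deg_on_nbrs[OF assms(1)] by (simp add: N_def)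
  have "(\<Sum>x\<in>W. (deg_on (insert u W) x)\<^sup>2)
      = (\<Sum>x\<in>W. (deg_on W x)\<^sup>2 + 2 * (A u x * deg_on W x) + A u x)"
    using assms by (intro sum.cong) (auto simp: deg_on_insert power2_eq_square algebra_simps)
  also have "\<dots> = (\<Sum>x\<in>W. (deg_on W x)\<^sup>2) + 2 * (\<Sum>x\<in>W. A u x * deg_on W x) + (\<Sum>x\<in>W. A u x)"
    by (simp add: sum.distrib sum_distrib_left)
  also have "(\<Sum>x\<in>W. A u x * deg_on W x) = (\<Sum>x\<in>N. deg_on W x)"
    using assms(1) by (intro sum.mono_neutral_cong_right) (auto simp: N_def A_def insert_commute)
  also have "\<dots> = (\<Sum>x\<in>W. deg_on N x)" by (rule sum_deg_swap)
  also have "(\<Sum>x\<in>W. A u x) = int (card N)" unfolding d deg_on_def by (simp add: A_sym)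
  finally show ?thesis using assms(1,2) by (simp add: deg_on_insert d[symmetric])
qed

lemma sum_sq_outside:
  assumes "finite W" "N \<subseteq> W"
  shows "(\<Sum>x\<in>W - N. (deg_on N x)\<^sup>2) \<le> int (card N) * (\<Sum>x\<in>W - N. deg_on N x)"
  unfolding sum_distrib_left power2_eq_square
  by (intro sum_mono mult_right_mono deg_on_le_card deg_on_nonneg)

lemma sum_sq_inside:
  assumes "finite N"
  shows "(\<Sum>x\<in>N. (deg_on N x)\<^sup>2) \<le> (int (card N) - 1) * (2 * size_on N)"
  unfolding handshake[OF assms, symmetric] sum_distrib_left power2_eq_square
  by (intro sum_mono mult_right_mono deg_on_less_card[OF assms] deg_on_nonneg)

lemma size_on_le:
  assumes "finite N"
  shows "2 * size_on N \<le> int (card N) * (int (card N) - 1)"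
  using sum_bounded_above[of N "deg_on N" "int (card N) - 1"] deg_on_less_card[OF assms]
  by (simp add: handshake[OF assms])

lemma sum_split_subset:
  fixes f :: "nat \<Rightarrow> int"
  assumes "finite W" "N \<subseteq> W"
  shows "(\<Sum>x\<in>W. f x) = (\<Sum>x\<in>N. f x) + (\<Sum>x\<in>W - N. f x)"
  using assms by (metis sum.subset_diff add.commute)

text \<open>Stars attain equality. Adding a vertex of degree \<open>d\<close> reduces the claim to:
  the codegrees sum to at most \<open>d * size_on W\<close>. An old edge is counted there once for
  each end in \<open>N\<close>, hence at most twice, and at most once if
  \<open>d = 1\<close>.\<close>

lemma sum_deg_sq_le:
  assumes "finite W"
  shows "(\<Sum>x\<in>W. (deg_on W x)\<^sup>2) \<le> size_on W * (size_on W + 1)"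
  using assms
proof (induction W rule: finite_induct)
  case (insert u W)
  define N where "N = {w \<in> W. {w, u} \<in> E}"
  have fN: "finite N" "N \<subseteq> W" using insert by (auto simp: N_def)
  define d where "d = int (card N)"
  have du: "deg_on W u = d" using deg_on_nbrs[OF insert(1)] by (simp add: N_def d_def)
  have sz: "2 * size_on N \<le> d * (d - 1)" using size_on_le[OF fN(1)] by (simp add: d_def)
  have sp: "(\<Sum>x\<in>W. deg_on N x) = 2 * size_on N + (\<Sum>x\<in>W - N. deg_on N x)"
    using sum_split_subset[OF insert(1) fN(2)] handshake[OF fN(1)] by simp
  have m: "size_on W \<ge> size_on N + (\<Sum>x\<in>W - N. deg_on N x)"
    using size_on_split[OF insert(1) fN(2)] size_on_nonneg[of "W - N"] by simp
  have out: "(\<Sum>x\<in>W - N. deg_on N x) \<ge> 0" by (simp add: sum_nonneg deg_on_nonneg)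
  have "(\<Sum>x\<in>W. deg_on N x) \<le> d * size_on W"
  proof -
    consider "d = 0" | "d = 1" | "d \<ge> 2" using d_def by linarith
    then show ?thesis
    proof cases
      case 1
      then show ?thesis using fN by (simp add: d_def deg_on_def)
    next
      case 2
      then show ?thesis using sz sp m size_on_nonneg[of N] by simp
    next
      case 3
      have "2 * size_on W \<le> d * size_on W" using 3 by (intro mult_right_mono size_on_nonneg)
      then show ?thesis using sp m out by linarith
    qed
  qed
  then show ?case
    using insert(3) unfolding sum_deg_sq_insert[OF insert(1,2)] size_on_insert[OF insert(1,2)] du
      N_def[symmetric] d_def[symmetric]
    by (simp add: algebra_simps power2_eq_square)
qed simp

text \<open>Controls the squared degrees that are subtracted when a vertex adjacent to all of
  \<open>W\<close> is added. In the induction everything cancels except the claim that the squared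
  codegrees plus twice the codegrees sum to at most \<open>3 * d * size_on W\<close>.\<close>

lemma a4_lower:
  assumes "finite W"
  shows "(\<Sum>x\<in>W. (deg_on W x)\<^sup>2) \<le> a4 (ind W) + size_on W * (size_on W + 1)"
  using assms
proof (induction W rule: finite_induct)
  case empty
  have "ind {} = {}" using card_edge by (fastforce simp: ind_def)
  then show ?case by (simp add: a4_def two_matchings_def four_cycles_def)
next
  case (insert u W)
  define N where "N = {w \<in> W. {w, u} \<in> E}"
  have fN: "finite N" "N \<subseteq> W" using insert by (auto simp: N_def)
  define d where "d = int (card N)"
  define out where "out = (\<Sum>x\<in>W - N. deg_on N x)"
  have du: "deg_on W u = d" using deg_on_nbrs[OF insert(1)] by (simp add: N_def d_def)
  have sz: "2 * size_on N \<le> d * (d - 1)" using size_on_le[OF fN(1)] by (simp add: d_def)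
  have sp: "(\<Sum>x\<in>W. deg_on N x) = 2 * size_on N + out"
    using sum_split_subset[OF insert(1) fN(2)] handshake[OF fN(1)] by (simp add: out_def)
  have m: "size_on W \<ge> size_on N + out"
    using size_on_split[OF insert(1) fN(2)] size_on_nonneg[of "W - N"] by (simp add: out_def)
  have out: "out \<ge> 0" by (simp add: sum_nonneg deg_on_nonneg out_def)
  have sq: "(\<Sum>x\<in>W. (deg_on N x)\<^sup>2) \<le> (d - 1) * (2 * size_on N) + d * out"
    using sum_split_subset[OF insert(1) fN(2), of "\<lambda>x. (deg_on N x)\<^sup>2"]
      sum_sq_inside[OF fN(1)] sum_sq_outside[OF insert(1) fN(2)] by (simp add: d_def out_def)
  have "(\<Sum>x\<in>W. (deg_on N x)\<^sup>2) + 2 * (\<Sum>x\<in>W. deg_on N x) \<le> 3 * d * size_on W"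
  proof -
    consider "d = 0" | "d = 1" | "d \<ge> 2" using d_def by linarith
    then show ?thesis
    proof cases
      case 1
      then show ?thesis using fN by (simp add: d_def deg_on_def)
    next
      case 2
      then show ?thesis using sz sp m sq size_on_nonneg[of N] by simp
    next
      case 3
      have "(d - 1) * (2 * size_on N) + d * out + 2 * (2 * size_on N + out)
        = (2 * d + 2) * size_on N + (d + 2) * out" by (simp add: algebra_simps)
      \<comment> \<open>Both coefficients are at most \<open>3 * d\<close> because \<open>d\<close>
        is at least 2.\<close>
      also have "\<dots> \<le> (3 * d) * size_on N + (3 * d) * out"
        using 3 out by (intro add_mono mult_right_mono size_on_nonneg) auto
      also have "\<dots> \<le> (3 * d) * size_on W"
        using m 3 by (simp add: distrib_left[symmetric])
      finally show ?thesis using sp sq by simp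
    qed
  qed
  then show ?case
    using insert(3) unfolding sum_deg_sq_insert[OF insert(1,2)] size_on_insert[OF insert(1,2)] du
      N_def[symmetric] d_def[symmetric] a4_insert[OF insert(1,2)]
    by (simp add: algebra_simps power2_eq_square)
qed

text \<open>This is \<open>B n m\<close> of the overview, the product of the sizes of
  \<open>Y_1\<close> and \<open>Y_2\<close>. As an integer polynomial it stays meaningful in the
  induction, where the number of edges may leave the range of the theorem.\<close>

definition bound :: "int \<Rightarrow> int \<Rightarrow> int" where
  "bound n m = (m - n + 2) * (2 * n - 4 - m)"

section \<open>Graphs with a vertex \<open>z\<close> that has exactly one non-neighbour
  \<open>u\<close>\<close>

context
  fixes W :: "nat set" and z u :: nat
  assumes W: "finite W" "z \<notin> W" "u \<notin> W" "z \<noteq> u"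
    and nadj: "{z, u} \<notin> E" and dom: "\<And>w. w \<in> W \<Longrightarrow> {w, z} \<in> E"
begin

lemma size_on_two_centres:
  "size_on (insert z (insert u W)) = size_on W + deg_on W u + int (card W)"
proof -
  have "{w \<in> insert u W. {w, z} \<in> E} = W"
    using nadj dom by (auto simp: insert_commute)
  then have "deg_on (insert u W) z = int (card W)"
    using W(1) deg_on_card[of "insert u W" z] by simp
  then show ?thesis using W by (simp add: size_on_insert)
qed

text \<open>Adds \<open>u\<close> to \<open>W\<close> and then \<open>z\<close>, whose neighbourhood
  is \<open>W\<close>. The last square is the codegree of \<open>z\<close> and
  \<open>u\<close>.\<close>

lemma a4_two_centres:
  "a4 (ind (insert z (insert u W))) = a4 (ind W) + deg_on W u * size_on W
    - (\<Sum>x\<in>W. (deg_on {w \<in> W. {w, u} \<in> E} x)\<^sup>2)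
    + int (card W) * (size_on W + deg_on W u) - (\<Sum>x\<in>W. (deg_on W x)\<^sup>2) - (deg_on W u)\<^sup>2"
proof -
  have "{w \<in> insert u W. {w, z} \<in> E} = W"
    using nadj dom by (auto simp: insert_commute)
  then have "a4 (ind (insert z (insert u W))) = a4 (ind (insert u W))
      + int (card W) * size_on (insert u W) - (\<Sum>x\<in>insert u W. (deg_on W x)\<^sup>2)"
    using a4_insert[of "insert u W" z] W by simp
  then show ?thesis
    using W by (simp add: a4_insert[of W u] size_on_insert deg_on_nbrs)
qed

text \<open>Once \<open>a4_lower\<close> is applied to \<open>W\<close>, what remains is that the
  squared codegrees with \<open>u\<close> sum to at most \<open>(3 * t - 2) * h\<close>. The surplus
  \<open>size_on W\<close> later settles the equality case.\<close>

lemma bound_two_centres: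
  assumes "deg_on W u \<ge> 1"
  defines "V \<equiv> insert z (insert u W)"
  shows "bound (int (card V)) (size_on V) + size_on W \<le> a4 (ind V)"
proof -
  define T where "T = {w \<in> W. {w, u} \<in> E}"
  have fT: "finite T" "T \<subseteq> W" using W by (auto simp: T_def)
  define t where "t = deg_on W u"
  define h where "h = size_on W"
  define out where "out = (\<Sum>x\<in>W - T. deg_on T x)"
  have t: "int (card T) = t" using deg_on_nbrs[OF W(1)] by (simp add: T_def t_def)
  have out: "out \<ge> 0" by (simp add: sum_nonneg deg_on_nonneg out_def)
  have "(\<Sum>x\<in>W. (deg_on T x)\<^sup>2) \<le> (t - 1) * (2 * size_on T) + t * out"
    using sum_split_subset[OF W(1) fT(2), of "\<lambda>x. (deg_on T x)\<^sup>2"]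
      sum_sq_inside[OF fT(1)] sum_sq_outside[OF W(1) fT(2)] by (simp add: t out_def)
  also have "\<dots> = (2 * t - 2) * size_on T + t * out" by (simp add: algebra_simps)
  \<comment> \<open>Here \<open>t\<close> at least 1 gives \<open>t\<close> at most
    \<open>3 * t - 2\<close>.\<close>
  also have "\<dots> \<le> (3 * t - 2) * size_on T + (3 * t - 2) * out"
    using assms out by (intro add_mono mult_right_mono size_on_nonneg) (auto simp: t_def)
  also have "\<dots> = (3 * t - 2) * (size_on T + out)" by (simp add: algebra_simps)
  also have "\<dots> \<le> (3 * t - 2) * h"
    using size_on_split[OF W(1) fT(2)] size_on_nonneg[of "W - T"] assms
    by (intro mult_left_mono) (auto simp: h_def out_def t_def)
  finally have *: "(\<Sum>x\<in>W. (deg_on T x)\<^sup>2) \<le> (3 * t - 2) * h" .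
  have "int (card V) = int (card W) + 2" using W by (simp add: V_def)
  moreover have "size_on V = h + t + int (card W)"
    by (simp add: V_def size_on_two_centres h_def t_def)
  ultimately have "bound (int (card V)) (size_on V) = (h + t) * (int (card W) - h - t)"
    by (simp add: bound_def algebra_simps)
  then show ?thesis
    using * a4_lower[OF W(1)] a4_two_centres
    unfolding V_def T_def[symmetric] h_def[symmetric] t_def[symmetric]
    by (simp add: algebra_simps power2_eq_square)
qed

end

section \<open>Connectedness in cut form, and the edges it forces\<close>

definition conn :: "nat set \<Rightarrow> bool" where
  "conn W \<longleftrightarrow> (\<forall>S. S \<subset> W \<and> S \<noteq> {} \<longrightarrow> (\<exists>x\<in>S. \<exists>y\<in>W - S. {x, y} \<in> E))"

text \<open>A maximal nonempty connected proper subset \<open>C\<close> misses only one vertex: some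
  edge leads from \<open>C\<close> to a vertex \<open>y\<close>, and \<open>insert y C\<close> is
  again connected, so it must be \<open>V\<close>.\<close>

lemma exists_non_cut_vertex:
  assumes "finite V" "card V \<ge> 2" "conn V"
  shows "\<exists>u\<in>V. conn (V - {u})"
proof -
  let ?F = "{C. C \<subset> V \<and> C \<noteq> {} \<and> conn C}"
  obtain v where v: "v \<in> V" using assms(2) by fastforce
  have "{v} \<noteq> V" using assms(2) by auto
  moreover have "conn {v}" unfolding conn_def by blast
  ultimately have "{v} \<in> ?F" using v by blast
  then have ne: "?F \<noteq> {}" by blast
  have "finite ?F" by (rule finite_subset[of _ "Pow V"]) (use assms in auto)
  from finite_has_maximal[OF this ne] obtain C where
    "C \<in> ?F" and max: "\<forall>D\<in>?F. C \<subseteq> D \<longrightarrow> C = D" ..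
  then have C: "C \<subset> V" "C \<noteq> {}" "conn C" by auto
  then obtain x y where xy: "x \<in> C" "y \<in> V - C" "{x, y} \<in> E"
    using assms(3) unfolding conn_def by meson
  have "conn (insert y C)"
    unfolding conn_def
  proof (intro allI impI)
    fix S assume S: "S \<subset> insert y C \<and> S \<noteq> {}"
    consider "S \<inter> C = {}" | "C \<subseteq> S" | "S \<inter> C \<subset> C" "S \<inter> C \<noteq> {}" by blast
    then show "\<exists>a\<in>S. \<exists>b\<in>insert y C - S. {a, b} \<in> E"
    proof cases
      case 1
      then have "S = {y}" using S by blast
      then show ?thesis using xy by (auto simp: insert_commute)
    next
      case 2
      then have "S = C" using S by blast
      then show ?thesis using xy by auto
    next
      case 3
      then have "\<exists>a\<in>S \<inter> C. \<exists>b\<in>C - S \<inter> C. {a, b} \<in> E" using C(3) unfolding conn_def by simp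
      then show ?thesis by blast
    qed
  qed
  then have "insert y C \<in> ?F" if "insert y C \<noteq> V" using that C xy by blast
  then have "insert y C = V" using max xy by blast
  then have "V - {y} = C" using xy by blast
  then show ?thesis using C(3) xy by auto
qed

text \<open>The vertices of \<open>Z\<close> can be put back in an order in which each is adjacent
  to something already present, so each brings back at least one edge.\<close>

lemma size_on_remove_ge:
  assumes "finite W" "conn W" "Z \<subset> W"
  shows "size_on (W - Z) + int (card Z) \<le> size_on W"
proof -
  have "finite Z" using assms finite_subset by auto
  then show ?thesis using assms(3)
  proof (induction Z rule: finite_psubset_induct)
    case (psubset Z)
    show ?case
    proof (cases "Z = {}")
      case False
      then obtain z y where zy: "z \<in> Z" "y \<in> W - Z" "{z, y} \<in> E"
        using assms(2) psubset.prems unfolding conn_def by blast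
      have "W - (Z - {z}) = insert z (W - Z)" using zy psubset.prems by blast
      then have "size_on (W - (Z - {z})) = size_on (W - Z) + deg_on (W - Z) z"
        using zy assms(1) by (simp add: size_on_insert)
      moreover have "deg_on (W - Z) z \<ge> deg_on {y} z"
        using zy assms(1) by (intro deg_on_mono) auto
      moreover have "deg_on {y} z = 1" using zy by (simp add: deg_on_def A_def insert_commute)
      moreover have "size_on (W - (Z - {z})) + int (card (Z - {z})) \<le> size_on W"
        using zy psubset.prems by (intro psubset.IH) auto
      moreover have "int (card Z) = int (card (Z - {z})) + 1"
        using card.remove[of Z z] zy psubset.hyps by simp
      ultimately show ?thesis by linarith
    qed simp
  qed
qed

lemma size_on_ge_card:
  assumes "finite W" "conn W" "W \<noteq> {}"
  shows "int (card W) - 1 \<le> size_on W"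
proof -
  obtain v where "v \<in> W" using assms(3) by blast
  then have "size_on (W - (W - {v})) + int (card (W - {v})) \<le> size_on W"
    by (intro size_on_remove_ge assms) auto
  moreover have "card W = Suc (card (W - {v}))"
    by (rule card.remove) fact+
  ultimately show ?thesis using size_on_nonneg[of "W - (W - {v})"] by linarith
qed

text \<open>By \<open>bound_remove\<close> below, \<open>F\<close> is the change of \<open>a4 - bound\<close> when a vertex with neighbourhood
  \<open>N\<close> is added to \<open>W\<close>.\<close>

lemma sum_codeg_sq_le:
  assumes "finite W" "conn W" "N \<subseteq> W" and d: "card N \<ge> 2"
  defines "d \<equiv> int (card N)"
  defines "F \<equiv> (3 * d - 3) * size_on W - (3 * d - 4) * int (card W) + d\<^sup>2 + 3 * d - 6
    - (\<Sum>x\<in>W. (deg_on N x)\<^sup>2)"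
  shows "d - 2 + size_on (W - N) \<le> F"
    and "d = 2 \<Longrightarrow> size_on (W - N) + size_on N \<le> F"
proof -
  \<comment> \<open>Outside \<open>N\<close>, the set \<open>S\<close> holds the vertices with a
    neighbour in \<open>N\<close> and \<open>Z\<close> the others. The edges number \<open>h\<close>
    inside \<open>N\<close>, \<open>out\<close> across and \<open>r\<close> outside.\<close>
  define S where "S = {x \<in> W - N. deg_on N x \<noteq> 0}"
  define Z where "Z = {x \<in> W - N. deg_on N x = 0}"
  define h where "h = size_on N"
  define r where "r = size_on (W - N)"
  define out where "out = (\<Sum>x\<in>W - N. deg_on N x)"
  define s where "s = int (card S)"
  define z where "z = int (card Z)"
  have d2: "d \<ge> 2" using d by (simp add: d_def)
  have fin: "finite N" "finite S" "finite Z" "finite (W - N)"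
    using assms(1,3) finite_subset by (auto simp: S_def Z_def)
  have WN: "W - N = S \<union> Z" "S \<inter> Z = {}" by (auto simp: S_def Z_def)
  have "card W = card N + card (W - N)"
    using assms(1,3) fin(1) by (metis card_mono card_Diff_subset le_add_diff_inverse)
  also have "card (W - N) = card S + card Z"
    unfolding WN(1) using fin WN(2) by (intro card_Un_disjoint)
  finally have n: "int (card W) = d + s + z" by (simp add: d_def s_def z_def)
  have m: "size_on W = h + out + r"
    using size_on_split[OF assms(1,3)] by (simp add: h_def out_def r_def)
  have h0: "h \<ge> 0" by (simp add: h_def size_on_nonneg)
  have "W \<noteq> {}" using d assms(3) by auto
  then have tree: "h + out + r \<ge> d + s + z - 1"
    using size_on_ge_card[OF assms(1,2)] n m by simp
  \<comment> \<open>Removing \<open>Z\<close> destroys at least \<open>z\<close> edges, and none of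
    them meets \<open>N\<close>, so all are counted by \<open>r\<close>.\<close>
  have rz: "r \<ge> z"
  proof -
    have ZN: "Z \<subseteq> W - N" "Z \<subseteq> W" by (auto simp: Z_def)
    have "N \<noteq> {}" using d by auto
    then have "Z \<subset> W" using ZN assms(3) by blast
    then have "size_on (W - Z) + z \<le> size_on W"
      using size_on_remove_ge[OF assms(1,2)] by (simp add: z_def)
    moreover have "size_on W = size_on Z + (\<Sum>x\<in>W - Z. deg_on Z x) + size_on (W - Z)"
      by (rule size_on_split[OF assms(1) ZN(2)])
    moreover have "r = size_on Z + (\<Sum>x\<in>W - N - Z. deg_on Z x) + size_on (W - N - Z)"
      unfolding r_def by (rule size_on_split[OF fin(4) ZN(1)])
    moreover have "(\<Sum>x\<in>W - Z. deg_on Z x) = (\<Sum>x\<in>W - N - Z. deg_on Z x)"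
    proof -
      have "W - Z - N = W - N - Z" "N \<subseteq> W - Z" using ZN assms(3) by auto
      then have "(\<Sum>x\<in>W - Z. deg_on Z x)
          = (\<Sum>x\<in>N. deg_on Z x) + (\<Sum>x\<in>W - N - Z. deg_on Z x)"
        using sum_split_subset[of "W - Z" N "deg_on Z"] assms(1) by simp
      moreover have "(\<Sum>x\<in>N. deg_on Z x) = (\<Sum>x\<in>Z. deg_on N x)" by (rule sum_deg_swap)
      ultimately show ?thesis by (simp add: Z_def)
    qed
    ultimately show ?thesis using size_on_nonneg[of "W - N - Z"] by linarith
  qed
  have sum_S: "(\<Sum>x\<in>W - N. f x) = (\<Sum>x\<in>S. f x) + (\<Sum>x\<in>Z. f x)" for f :: "nat \<Rightarrow> int"
    unfolding WN(1) using fin WN(2) by (intro sum.union_disjoint)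
  have out_S: "out = (\<Sum>x\<in>S. deg_on N x)" unfolding out_def sum_S by (simp add: Z_def)
  have t: "1 \<le> deg_on N x" "deg_on N x \<le> d" if "x \<in> S" for x
    using that deg_on_nonneg[of N x] deg_on_le_card[of N x] by (auto simp: S_def d_def)
  have outs: "out \<ge> s"
    unfolding out_S s_def using sum_mono[of S "\<lambda>_. 1" "deg_on N"] t by simp
  have "(\<Sum>x\<in>W - N. (deg_on N x)\<^sup>2) = (\<Sum>x\<in>S. (deg_on N x)\<^sup>2)"
    unfolding sum_S by (simp add: Z_def)
  also have "\<dots> \<le> (\<Sum>x\<in>S. (d + 1) * deg_on N x - d)"
  proof (rule sum_mono)
    fix x assume "x \<in> S"
    \<comment> \<open>On the interval from 1 to \<open>d\<close> the square lies below its
      chord.\<close>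
    then have "0 \<le> (deg_on N x - 1) * (d - deg_on N x)"
      using t[of x] by (intro mult_nonneg_nonneg) linarith+
    then show "(deg_on N x)\<^sup>2 \<le> (d + 1) * deg_on N x - d"
      by (simp add: algebra_simps power2_eq_square)
  qed
  also have "\<dots> = (d + 1) * out - d * s"
    by (simp add: sum_subtractf sum_distrib_left out_S s_def mult.commute)
  finally have sq_out: "(\<Sum>x\<in>W - N. (deg_on N x)\<^sup>2) \<le> (d + 1) * out - d * s" .
  define q where "q = (\<Sum>x\<in>N. (deg_on N x)\<^sup>2)"
  have q1: "q \<le> h * (h + 1)" using sum_deg_sq_le[OF fin(1)] by (simp add: q_def h_def)
  have q2: "q \<le> (d - 1) * (2 * h)" using sum_sq_inside[OF fin(1)] by (simp add: q_def h_def d_def)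
  have "(\<Sum>x\<in>W. (deg_on N x)\<^sup>2) \<le> q + (d + 1) * out - d * s"
    using sum_split_subset[OF assms(1,3), of "\<lambda>x. (deg_on N x)\<^sup>2"] sq_out by (simp add: q_def)
  then have F: "F \<ge> (3 * d - 3) * (h + r) + (2 * d - 4) * (out - s) - (3 * d - 4) * z
      - (2 * d - 3) * (d - 2) - q"
    unfolding F_def n m by (simp add: algebra_simps power2_eq_square)
  \<comment> \<open>Uses up the slack of \<open>tree\<close> with weight \<open>2 * d - 4\<close>
    and that of \<open>rz\<close> with weight \<open>d\<close>, then bounds \<open>q\<close> by
    \<open>q1\<close>.\<close>
  have small: "F \<ge> d - 2 + r + h * (d - h)"
  proof -
    have "0 \<le> (2 * d - 4) * (h + out + r - s - z - (d - 1))" using tree d2 by simp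
    moreover have "0 \<le> d * (r - z)" using rz d2 by simp
    ultimately show ?thesis using F q1 by (simp add: algebra_simps)
  qed
  show "d - 2 + r \<le> F"
  proof (cases "h \<le> d")
    case True
    then have "0 \<le> h * (d - h)" using h0 by simp
    then show ?thesis using small by linarith
  next
    case False
    \<comment> \<open>With \<open>h > d\<close> the edges inside \<open>N\<close> pay for the
      constant term without \<open>tree\<close>: through \<open>q1\<close> while \<open>h\<close> is
      at most \<open>2 * d - 3\<close>, through \<open>q2\<close> beyond.\<close>
    have "(3 * d - 3) * h - q \<ge> (d - 1) * (2 * d - 4)"
    proof (cases "h \<le> 2 * d - 3")
      case True
      have "0 \<le> (h - d) * (2 * d - 3 - h)" using True False by simp
      moreover have "0 \<le> (d - 1) * (h - d)" using False d2 by simp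
      ultimately show ?thesis using q1 d2 True by (simp add: algebra_simps)
    next
      case False
      then have "0 \<le> (d - 1) * (h - (2 * d - 4))" using d2 by simp
      then show ?thesis using q2 by (simp add: algebra_simps)
    qed
    moreover have "0 \<le> (2 * d - 4) * (out - s)" "0 \<le> (3 * d - 4) * (r - z)"
      using outs rz d2 by simp_all
    ultimately show ?thesis using F by (simp add: algebra_simps)
  qed
  show "r + h \<le> F" if "d = 2"
  proof -
    \<comment> \<open>Two vertices span at most one edge, and \<open>h * (2 - h) = h\<close> for
      \<open>h\<close> equal to 0 or 1.\<close>
    have "2 * h \<le> d * (d - 1)" using size_on_le[OF fin(1)] by (simp add: d_def h_def)
    then have "h = 0 \<or> h = 1" using that h0 by auto
    then show ?thesis using small that by auto
  qed
qed

section \<open>Induction on the number of vertices\<close>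

lemma bound_remove:
  "d * m - q - (bound (n + 1) (m + d) - bound n m)
    = (3 * d - 3) * m - (3 * d - 4) * n + d\<^sup>2 + 3 * d - 6 - q"
  by (simp add: bound_def algebra_simps power2_eq_square)

lemma conn_nbr:
  assumes "conn V" "u \<in> V" "V \<noteq> {u}"
  shows "\<exists>w\<in>V - {u}. {w, u} \<in> E"
proof -
  have "{u} \<subset> V \<and> {u} \<noteq> {}" using assms by blast
  then have "\<exists>x\<in>{u}. \<exists>y\<in>V - {u}. {x, y} \<in> E" using assms(1) unfolding conn_def by meson
  then show ?thesis by (simp add: insert_commute)
qed

text \<open>The degree of \<open>z\<close> leaves exactly one non-neighbour \<open>u\<close>. By
  connectedness \<open>u\<close> has a neighbour, and this is not \<open>z\<close>, so it lies in
  \<open>W\<close>.\<close>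

lemma near_dominating_split:
  assumes "finite V" "conn V" "z \<in> V" "deg_on V z = int (card V) - 2"
  obtains u W where "V = insert z (insert u W)" "finite W" "z \<notin> W" "u \<notin> W" "z \<noteq> u"
    "{z, u} \<notin> E" "\<And>w. w \<in> W \<Longrightarrow> {w, z} \<in> E" "deg_on W u \<ge> 1"
proof -
  define W where "W = {w \<in> V. {w, z} \<in> E}"
  have loop: "{z} \<notin> E" using card_edge[of "{z}"] by auto
  have W: "finite W" "W \<subseteq> V - {z}" using assms(1) loop by (auto simp: W_def)
  have "int (card W) = int (card V) - 2" using assms(1,4) deg_on_card[of V z] by (simp add: W_def)
  moreover have "card (V - {z} - W) = card (V - {z}) - card W" using W by (simp add: card_Diff_subset)
  moreover have "card V = Suc (card (V - {z}))" using assms by (intro card.remove)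
  ultimately have "card (V - {z} - W) = 1" by linarith
  then obtain u where u: "V - {z} - W = {u}" by (auto simp: card_1_singleton_iff)
  have V: "V = insert z (insert u W)" using u W(2) assms(3) by blast
  have un: "u \<notin> W" "z \<noteq> u" "z \<notin> W" using u W(2) by blast+
  have "u \<in> V" using u by blast
  then have zu: "{u, z} \<notin> E" using un(1) by (simp add: W_def)
  have "V \<noteq> {u}" using assms(3) un(2) by blast
  then obtain w where w: "w \<in> V - {u}" "{w, u} \<in> E"
    using conn_nbr[OF assms(2) \<open>u \<in> V\<close>] by meson
  have "w \<noteq> z" using w(2) zu by (auto simp: insert_commute)
  then have "w \<in> W" using w(1) V by blast
  then have "deg_on {w} u \<le> deg_on W u" using W(1) by (intro deg_on_mono) auto
  moreover have "deg_on {w} u = 1" using w by (simp add: deg_on_def A_def)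
  ultimately show ?thesis using that[OF V W(1) un(3,1,2)] zu by (simp add: W_def insert_commute)
qed

text \<open>The weak and the strict inequality are proved together, since the tight case
  \<open>d = 2\<close> draws on the strict one for the smaller graph.\<close>

lemma bound_le_a4:
  assumes "finite V" "conn V" "V \<noteq> {}" "\<And>x. x \<in> V \<Longrightarrow> deg_on V x \<le> int (card V) - 2"
  shows "bound (int (card V)) (size_on V) \<le> a4 (ind V)
    \<and> ((\<forall>x\<in>V. deg_on V x \<le> int (card V) - 3) \<longrightarrow> bound (int (card V)) (size_on V) < a4 (ind V))"
  using assms
proof (induction "card V" arbitrary: V rule: less_induct)
  case less
  show ?case
  proof (cases "\<exists>z\<in>V. deg_on V z = int (card V) - 2")
    case True
    then obtain z where z: "z \<in> V" "deg_on V z = int (card V) - 2" by blast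
    obtain u W where "V = insert z (insert u W)" "finite W" "z \<notin> W" "u \<notin> W" "z \<noteq> u"
      "{z, u} \<notin> E" "\<And>w. w \<in> W \<Longrightarrow> {w, z} \<in> E" "deg_on W u \<ge> 1"
      using near_dominating_split[OF less.prems(1,2) z] by blast
    then have "bound (int (card V)) (size_on V) + size_on W \<le> a4 (ind V)"
      using bound_two_centres[of W z u] by blast
    then show ?thesis using size_on_nonneg[of W] z by force
  next
    case False
    then have deg: "deg_on V x \<le> int (card V) - 3" if "x \<in> V" for x
      using less.prems(4)[OF that] that by force
    obtain v where "v \<in> V" using less.prems(3) by blast
    then have card3: "card V \<ge> 3" using deg[of v] deg_on_nonneg[of V v] by linarith
    obtain u where u: "u \<in> V" "conn (V - {u})"
      using exists_non_cut_vertex[of V] less.prems card3 by auto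
    define W where "W = V - {u}"
    define N where "N = {w \<in> W. {w, u} \<in> E}"
    define d where "d = int (card N)"
    define n where "n = int (card W)"
    define F where "F = (3 * d - 3) * size_on W - (3 * d - 4) * n + d\<^sup>2 + 3 * d - 6
      - (\<Sum>x\<in>W. (deg_on N x)\<^sup>2)"
    have W: "finite W" "u \<notin> W" "V = insert u W" "conn W" using less.prems(1) u by (auto simp: W_def)
    have N: "finite N" "N \<subseteq> W" using W by (auto simp: N_def)
    have cV: "int (card V) = n + 1" using W by (simp add: n_def)
    have Wne: "W \<noteq> {}" using card3 W(3) by auto
    have "V \<noteq> {u}" using card3 by auto
    then have "\<exists>w\<in>W. {w, u} \<in> E" unfolding W_def by (rule conn_nbr[OF less.prems(2) u(1)])
    then have "N \<noteq> {}" by (auto simp: N_def)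
    then have "card N > 0" using N(1) by (simp add: card_gt_0_iff)
    then have d1: "d \<ge> 1" by (simp add: d_def)
    have du: "deg_on W u = d" using deg_on_nbrs[OF W(1)] by (simp add: N_def d_def)
    have sV: "size_on V = size_on W + d" using W by (simp add: size_on_insert du)
    have aV: "a4 (ind V) = a4 (ind W) + d * size_on W - (\<Sum>x\<in>W. (deg_on N x)\<^sup>2)"
      using a4_insert[OF W(1,2)] W(3) by (simp add: N_def d_def)
    have degV: "deg_on V x = deg_on W x + A u x" for x using W by (simp add: deg_on_insert)
    \<comment> \<open>As \<open>card V\<close> is \<open>n + 1\<close>, the bound
      \<open>card V - 3\<close> is \<open>n - 2\<close>, just what the induction hypothesis asks of
      \<open>W\<close>.\<close>
    have degW: "deg_on W x \<le> n - 2" if "x \<in> W" for x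
      using deg[of x] that W(3) cV degV[of x] A_bounds(1)[of u x] by simp
    have IH: "bound n (size_on W) \<le> a4 (ind W)"
      "(\<And>x. x \<in> W \<Longrightarrow> deg_on W x \<le> n - 3) \<Longrightarrow> bound n (size_on W) < a4 (ind W)"
      using less.hyps[of W] W Wne degW cV by (auto simp: n_def)
    have step: "a4 (ind V) - bound (int (card V)) (size_on V) = a4 (ind W) - bound n (size_on W) + F"
      using bound_remove[of d "size_on W" "\<Sum>x\<in>W. (deg_on N x)\<^sup>2" n]
      by (simp add: aV cV sV F_def)
    \<comment> \<open>A neighbour of \<open>u\<close> also loses its edge to
      \<open>u\<close>.\<close>
    have degN: "deg_on W x \<le> n - 3" if "x \<in> N" for x
      using deg[of x] that W(3) cV degV[of x] by (auto simp: N_def A_def insert_commute)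
    have "bound (int (card V)) (size_on V) < a4 (ind V)"
    proof -
      consider "d = 1" | "d = 2" | "d \<ge> 3" using d1 by linarith
      then show ?thesis
      proof cases
        case 1
        then obtain w where w: "N = {w}" by (auto simp: d_def card_1_singleton_iff)
        have "(\<Sum>x\<in>W. (deg_on N x)\<^sup>2) = deg_on W w"
          unfolding w by (simp add: deg_on_def power2_eq_square A_sym)
        \<comment> \<open>For \<open>d = 1\<close>, \<open>F\<close> simplifies to
          \<open>n - 2 - deg_on W w\<close>.\<close>
        then have "F > 0" using 1 degN[of w] w by (simp add: F_def)
        then show ?thesis using step IH(1) by linarith
      next
        case 3
        then have "F > 0"
          using sum_codeg_sq_le(1)[OF W(1,4) N(2)] size_on_nonneg[of "W - N"]
          by (simp add: F_def d_def n_def)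
        then show ?thesis using step IH(1) by linarith
      next
        case 2
        then have F: "size_on (W - N) + size_on N \<le> F"
          using sum_codeg_sq_le(2)[OF W(1,4) N(2)] by (simp add: F_def d_def n_def)
        show ?thesis
        proof (cases "F > 0")
          case True
          then show ?thesis using step IH(1) by linarith
        next
          case False
          \<comment> \<open>Without a gain from \<open>F\<close>, every edge of \<open>W\<close>
            joins \<open>N\<close> to \<open>W - N\<close>; strictness has to come from the
            induction hypothesis.\<close>
          then have zero: "size_on (W - N) = 0" "size_on N = 0" "F \<ge> 0"
            using F size_on_nonneg[of N] size_on_nonneg[of "W - N"] by linarith+
          have split: "deg_on W x = deg_on N x + deg_on (W - N) x" for x
            unfolding deg_on_def by (rule sum_split_subset[OF W(1) N(2)])
          have no_edge: "deg_on X x = 0" if "size_on X = 0" "finite X" "x \<in> X" for X x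
            using handshake[OF that(2)] that deg_on_nonneg[of X]
              sum_nonneg_eq_0_iff[OF that(2), of "deg_on X"] by simp
          \<comment> \<open>Counted from \<open>N\<close>, there are at most
            \<open>2 * (n - 3)\<close> edges, while connectedness requires \<open>n - 1\<close>. So
            \<open>n\<close> is at least 5, and the degrees outside \<open>N\<close>, at most 2, do
            not exceed \<open>n - 3\<close>.\<close>
          have "size_on W = (\<Sum>x\<in>W - N. deg_on N x)"
            using size_on_split[OF W(1) N(2)] zero by simp
          also have "\<dots> = (\<Sum>x\<in>N. deg_on (W - N) x)" by (rule sum_deg_swap)
          also have "\<dots> \<le> (\<Sum>x\<in>N. n - 3)"
          proof (rule sum_mono)
            fix x assume "x \<in> N"
            then show "deg_on (W - N) x \<le> n - 3"
              using degN[of x] split[of x] deg_on_nonneg[of N x] by simp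
          qed
          also have "\<dots> = 2 * (n - 3)" using 2 by (simp add: d_def)
          finally have "n \<ge> 5" using size_on_ge_card[OF W(1,4) Wne] by (simp add: n_def)
          have "deg_on W x \<le> n - 3" if "x \<in> W" for x
          proof (cases "x \<in> N")
            case False
            then have "deg_on W x = deg_on N x"
              using split[of x] no_edge[OF zero(1), of x] that W(1) by simp
            then show ?thesis using deg_on_le_card[of N x] 2 \<open>n \<ge> 5\<close> by (simp add: d_def)
          qed (rule degN)
          then have "bound n (size_on W) < a4 (ind W)" by (rule IH(2))
          then show ?thesis using step zero(3) by linarith
        qed
      qed
    qed
    then show ?thesis by simp
  qed
qed

section \<open>Difference graphs and the equality case\<close>

lemma a4_difference_graph:
  assumes "finite W" "z \<notin> W" "u \<notin> W" "z \<noteq> u" "{z, u} \<notin> E" "\<And>w. w \<in> W \<Longrightarrow> {w, z} \<in> E"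
    and "ind W = {}"
  defines "V \<equiv> insert z (insert u W)"
  shows "size_on V = deg_on W u + int (card W)"
    and "a4 (ind V) = bound (int (card V)) (size_on V)"
proof -
  have no_edge: "{w, x} \<notin> E" if "w \<in> W" "x \<in> W" for w x
    using assms(7) that by (auto simp: ind_def)
  have "deg_on X x = 0" if "x \<in> W" "X \<subseteq> W" for X x
    unfolding deg_on_def A_def by (rule sum.neutral) (use that no_edge in auto)
  moreover have sz: "size_on W = 0" using assms(7) by (simp add: size_on_def)
  moreover have "a4 {} = 0" by (simp add: a4_def two_matchings_def four_cycles_def)
  \<comment> \<open>All sums over \<open>W\<close> vanish in \<open>a4_two_centres\<close> because
    \<open>W\<close> spans no edge.\<close>
  ultimately have "a4 (ind V) = int (card W) * deg_on W u - (deg_on W u)\<^sup>2"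
    using a4_two_centres[OF assms(1-6)] assms(7) by (simp add: V_def)
  moreover show sV: "size_on V = deg_on W u + int (card W)"
    using size_on_two_centres[OF assms(1-6)] sz by (simp add: V_def)
  moreover have "int (card V) = int (card W) + 2" using assms(1-4) by (simp add: V_def)
  ultimately show "a4 (ind V) = bound (int (card V)) (size_on V)"
    by (simp add: bound_def algebra_simps power2_eq_square)
qed

end

text \<open>A path from a vertex of \<open>S\<close> to one outside has a step that leaves
  \<open>S\<close>.\<close>

lemma conn_if_connected_graph:
  assumes "simple_graph n E" "connected_graph n E"
  shows "sgraph.conn E {0..<n}"
proof -
  interpret sgraph E using assms(1) by unfold_locales (auto simp: simple_graph_def)
  show ?thesis
    unfolding conn_def
  proof (intro allI impI)
    fix S assume S: "S \<subset> {0..<n} \<and> S \<noteq> {}"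
    then obtain a b where ab: "a \<in> S" "b \<in> {0..<n} - S" by blast
    then have "(a, b) \<in> (adj_rel E)\<^sup>*" using assms(2) S by (auto simp: connected_graph_def)
    then have "b \<notin> S \<longrightarrow> (\<exists>x\<in>S. \<exists>y\<in>{0..<n} - S. {x, y} \<in> E)"
    proof (induction rule: rtrancl_induct)
      case (step y z)
      then have yz: "{y, z} \<in> E" by (simp add: adj_rel_def)
      then have "z \<in> {0..<n}" using assms(1) by (auto simp: simple_graph_def)
      then show ?case using step.IH yz by blast
    qed (use ab in simp)
    then show "\<exists>x\<in>S. \<exists>y\<in>{0..<n} - S. {x, y} \<in> E" using ab by blast
  qed
qed

text \<open>Supplies the upper bound on the minimum. Vertices 0 and 1 act as \<open>x_1\<close> and
  \<open>x_2\<close>, with \<open>{2..<k + 2}\<close> as \<open>Y_1\<close> and the remaining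
  vertices as \<open>Y_2\<close>.\<close>

lemma exists_difference_graph:
  assumes "1 \<le> k" "k + 2 \<le> n"
  shows "\<exists>H\<in>graphs_nm n (n - 2 + k). a4 H = int k * (int n - 2 - int k)"
proof -
  define E where "E = {{0, y} | y. y \<in> {2..<n}} \<union> {{1, y} | y. y \<in> {2..<k + 2}}"
  define W where "W = {2..<n}"
  have V: "insert 0 (insert 1 W) = {0..<n}" using assms by (auto simp: W_def)
  interpret sgraph E by unfold_locales (auto simp: E_def card_insert_if)
  have sub: "e \<subseteq> {0..<n}" if "e \<in> E" for e using that assms by (auto simp: E_def)
  then have ind: "ind {0..<n} = E" by (auto simp: ind_def)
  have one: "{w, 1} \<in> E \<longleftrightarrow> w \<in> {2..<k + 2}" for w
    using assms by (auto simp: E_def doubleton_eq_iff)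
  have zero: "{w, 0} \<in> E \<longleftrightarrow> w \<in> W" for w
    using assms by (auto simp: E_def W_def doubleton_eq_iff)
  have "{w \<in> W. {w, 1} \<in> E} = {2..<k + 2}" unfolding one using assms by (auto simp: W_def)
  then have deg: "deg_on W 1 = int k" using deg_on_card[of W 1] by (simp add: W_def)
  have "\<not> e \<subseteq> W" if "e \<in> E" for e using that by (auto simp: E_def W_def)
  then have "ind W = {}" by (auto simp: ind_def)
  then have a4: "size_on {0..<n} = int k + int (card W)"
    "a4 (ind {0..<n}) = bound (int (card {0..<n})) (size_on {0..<n})"
    using a4_difference_graph[of W 0 1] zero one deg unfolding V by (auto simp: W_def)
  have cW: "int (card W) = int n - 2" using assms by (simp add: W_def of_nat_diff)
  have "int (card E) = int k + (int n - 2)" using a4(1) cW by (simp add: size_on_def ind)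
  then have "card E = n - 2 + k" using assms by linarith
  moreover have "simple_graph n E" using sub card_edge by (simp add: simple_graph_def)
  moreover have "connected_graph n E"
  proof -
    have edge: "(v, w) \<in> (adj_rel E)\<^sup>*" if "{v, w} \<in> E" for v w
      using that by (auto simp: adj_rel_def)
    have "(v, 0) \<in> (adj_rel E)\<^sup>* \<and> (0, v) \<in> (adj_rel E)\<^sup>*" if "v \<in> {0..<n}" for v
    proof -
      have W0: "(v, 0) \<in> (adj_rel E)\<^sup>* \<and> (0, v) \<in> (adj_rel E)\<^sup>*" if "v \<in> W" for v
        using zero[of v] that edge[of v 0] edge[of 0 v] by (simp add: insert_commute)
      \<comment> \<open>As \<open>k\<close> is at least 1, vertex 2 lies in \<open>Y_1\<close> and
        links 1 to 0.\<close>
      have "{2, 1} \<in> E" "2 \<in> W" using assms one[of 2] by (auto simp: W_def)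
      then have "(1, 0) \<in> (adj_rel E)\<^sup>* \<and> (0, 1) \<in> (adj_rel E)\<^sup>*"
        using W0[of 2] edge[of 2 1] edge[of 1 2] by (auto simp: insert_commute intro: rtrancl_trans)
      moreover have "v = 0 \<or> v = 1 \<or> v \<in> W" using that unfolding V[symmetric] by simp
      ultimately show ?thesis using W0[of v] by (elim disjE) simp_all
    qed
    then show ?thesis unfolding connected_graph_def by (meson rtrancl_trans)
  qed
  moreover have "a4 E = int k * (int n - 2 - int k)"
    using a4(2) unfolding a4(1) cW by (simp add: ind bound_def algebra_simps)
  ultimately show ?thesis by (auto simp: graphs_nm_def)
qed

theorem theorem4p7:
  fixes n m :: nat and E :: "nat set set"
  assumes "n \<ge> 6" and "n - 1 \<le> m" and "m \<le> 2 * n - 4"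
    and "sachs4_minimal n m E"
    and "max_degree n E < n - 1"
  shows "\<exists>x1 x2 Y1 Y2. x1 \<noteq> x2 \<and> x1 \<notin> Y1 \<union> Y2 \<and> x2 \<notin> Y1 \<union> Y2 \<and> Y1 \<inter> Y2 = {}
     \<and> {0..<n} = {x1, x2} \<union> Y1 \<union> Y2
     \<and> card Y1 = m + 2 - n \<and> card Y2 = 2 * n - 4 - m
     \<and> E = {{x1, y} | y. y \<in> Y1 \<union> Y2} \<union> {{x2, y} | y. y \<in> Y1}"
proof -
  define V where "V = {0..<n}"
  have min: "a4 E \<le> a4 H" if "H \<in> graphs_nm n m" for H
    using assms(4) that by (simp add: sachs4_minimal_def)
  have G: "simple_graph n E" "connected_graph n E" "card E = m"
    using assms(4) by (auto simp: sachs4_minimal_def graphs_nm_def)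
  interpret sgraph E using G(1) by unfold_locales (auto simp: simple_graph_def)
  have V: "finite V" "V \<noteq> {}" "card V = n" using assms(1) by (auto simp: V_def)
  have conn: "conn V" unfolding V_def by (rule conn_if_connected_graph[OF G(1,2)])
  have ind: "ind V = E" using G(1) by (auto simp: ind_def simple_graph_def V_def)
  have size: "size_on V = int m" by (simp add: size_on_def ind G(3))
  have deg: "deg_on V x \<le> int (card V) - 2" if "x \<in> V" for x
  proof -
    have "{w \<in> V. {w, x} \<in> E} = {w. {w, x} \<in> E}"
      using G(1) by (auto simp: simple_graph_def V_def)
    then have "deg_on V x = int (degree E x)" using deg_on_card[OF V(1)] by (simp add: degree_def)
    moreover have "degree E x \<le> max_degree n E"
      unfolding max_degree_def using that by (intro Max_ge) (auto simp: V_def)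
    ultimately show ?thesis using assms(1,5) V(3) by linarith
  qed
  have "a4 E \<le> bound (int n) (int m)"
  proof -
    \<comment> \<open>Written \<open>m + 2 - n\<close> because \<open>m - n\<close> would be
      truncated to 0 when \<open>m = n - 1\<close>.\<close>
    have k: "n - 2 + (m + 2 - n) = m" "1 \<le> m + 2 - n" "m + 2 - n + 2 \<le> n"
      using assms(1-3) by arith+
    obtain H where "H \<in> graphs_nm n m" "a4 H = int (m + 2 - n) * (int n - 2 - int (m + 2 - n))"
      using exists_difference_graph[OF k(2,3)] unfolding k(1) by blast
    moreover have "int (m + 2 - n) = int m + 2 - int n" using assms(1,2) by linarith
    ultimately show ?thesis using min[of H] by (simp add: bound_def algebra_simps)
  qed
  then have le: "a4 (ind V) \<le> bound (int (card V)) (size_on V)" by (simp add: ind V(3) size)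
  \<comment> \<open>If all degrees were at most \<open>n - 3\<close>, the strict inequality would
    contradict \<open>le\<close>.\<close>
  then obtain z where "z \<in> V" "\<not> deg_on V z \<le> int (card V) - 3"
    using bound_le_a4[OF V(1) conn V(2) deg] by fastforce
  then have z: "z \<in> V" "deg_on V z = int (card V) - 2" using deg[of z] by auto
  obtain u W where W: "V = insert z (insert u W)" "finite W" "z \<notin> W" "u \<notin> W" "z \<noteq> u"
    "{z, u} \<notin> E" "\<And>w. w \<in> W \<Longrightarrow> {w, z} \<in> E" "deg_on W u \<ge> 1"
    using near_dominating_split[OF V(1) conn z] by blast
  \<comment> \<open>The surplus in \<open>bound_two_centres\<close> is squeezed out by
    \<open>le\<close>.\<close>
  have "size_on W = 0"
    using bound_two_centres[OF W(2-8)] le size_on_nonneg[of W] by (simp add: W(1))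
  then have "ind W = {}" using finite_ind[OF W(2)] by (simp add: size_on_def)
  \<comment> \<open>\<open>T\<close> becomes \<open>Y_1\<close> and \<open>W - T\<close> becomes
    \<open>Y_2\<close>, with \<open>z\<close> as \<open>x_1\<close> and \<open>u\<close> as
    \<open>x_2\<close>.\<close>
  define T where "T = {w \<in> W. {w, u} \<in> E}"
  have T: "finite T" "T \<subseteq> W" using W(2) by (auto simp: T_def)
  have cV: "n = card W + 2" using W(1-5) V(3) by simp
  have "int m = int (card T) + int (card W)"
    using a4_difference_graph(1)[OF W(2-7) \<open>ind W = {}\<close>] deg_on_nbrs(2)[OF W(2), of u] size
    by (simp add: W(1) T_def)
  then have cT: "card T = m + 2 - n" using cV by linarith
  have cR: "card (W - T) = 2 * n - 4 - m"
    using cT cV T \<open>int m = int (card T) + int (card W)\<close> by (simp add: card_Diff_subset)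
  have "{w \<in> insert u W. {z, w} \<in> E} = W" using W(6,7) by (auto simp: insert_commute)
  then have "E = (\<lambda>w. {z, w}) ` W \<union> (\<lambda>w. {u, w}) ` T"
    using ind unfolding W(1) ind_insert \<open>ind W = {}\<close> T_def by (auto simp: insert_commute)
  then have "E = {{z, y} | y. y \<in> T \<union> (W - T)} \<union> {{u, y} | y. y \<in> T}" using T(2) by blast
  moreover have "{0..<n} = {z, u} \<union> T \<union> (W - T)" using W(1) T(2) unfolding V_def by blast
  moreover have "z \<notin> T \<union> (W - T)" "u \<notin> T \<union> (W - T)" "T \<inter> (W - T) = {}" using W(3,4) T(2) by auto
  ultimately show ?thesis using cT cR W(5)
    by (intro exI[of _ z] exI[of _ u] exI[of _ T] exI[of _ "W - T"] conjI)
qed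

end
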